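(* Let $n\ge 0$ and $m>1$ be integers, and let $d_{n+3}=|D_{n+3}|$. Then $$d_{n+3}\equiv H(D_n\times D_n\times D_n)\equiv H(E^c_{n,m}\times E^c_{n,m}\times E^c_{n,m})\pmod m$$ and $$d_{n+3}\equiv\sum_{x\in R_n\cap E^c_{n,m}}\ \sum_{y\in E^c_{n,m}}\ \sum_{z\in E^c_{n,m}}\gamma(x)\cdot H(x,y,z)\pmod m.$$
   Context: $D_n$ is the set of monotone Boolean functions $\{0,1\}^n\to\{0,1\}$ ($\{0,1\}^n$ ordered componentwise), partially ordered pointwise. $\top,\bot$ are the constant functions $1,0$; $x|y$ and $x\&y$ are pointwise max and min; $\mathrm{re}(x,y)=|\{z\in D_n:x\le z\le y\}|$. For $x,y,z\in D_n$, $$H(x,y,z)=\mathrm{re}(\bot,x\&y\&z)\cdot\sum_{s\in D_n,\ s\ge x|y|z}\mathrm{re}(x|y,s)\cdot\mathrm{re}(x|z,s)\cdot\mathrm{re}(y|z,s),$$ and for $A\subseteq D_n^3$, $H(A)=\sum_{(x,y,z)\in A}H(x,y,z)$. A permutation $\pi\in S_n$ acts on $g\in D_n$ by $\pi(g)=g\circ\pi$ where $\pi(u)=u\circ\pi$ for $u\in\{0,1\}^n$. $f\sim g$ iff $f=\pi(g)$ for some $\pi\in S_n$; $[f]$ is the class of $f$, $\gamma(f)=|[f]|$. $E_{n,m}=\{f\in D_n:\gamma(f)\equiv0\pmod m\}$, $E^c_{n,m}=D_n\setminus E_{n,m}$. $R_n$ is the set of equivalence classes, each identified with its canonical representative, namely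 its minimal element with respect to a fixed total order on $D_n$ (the paper uses the order obtained by reading the truth table as a binary integer); thus $R_n\subseteq D_n$ contains exactly one element of each class. *)

theory Defs
  imports "HOL-Combinatorics.Permutations" "HOL-Number_Theory.Cong" "HOL-Library.FuncSet"
begin

text \<open>
  Points of the cube and Boolean functions on it are extensional functions (value
  \<^const>\<open>undefined\<close> outside the domain).  Since that default is a single truth value, the
  library's pointwise order, \<^const>\<open>sup\<close> and \<^const>\<open>inf\<close> on functions are the intended
  componentwise ones, and all these sets are finite.
\<close>

definition cube :: "nat \<Rightarrow> (nat \<Rightarrow> bool) set" where
  "cube n = {..<n} \<rightarrow>\<^sub>E UNIV"

definition mbf :: "nat \<Rightarrow> ((nat \<Rightarrow> bool) \<Rightarrow> bool) set" where
  "mbf n = {f \<in> cube n \<rightarrow>\<^sub>E UNIV. mono_on (cube n) f}"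

definition mbf_bot :: "nat \<Rightarrow> (nat \<Rightarrow> bool) \<Rightarrow> bool" where
  "mbf_bot n = (\<lambda>u\<in>cube n. False)"

definition re :: "nat \<Rightarrow> ((nat \<Rightarrow> bool) \<Rightarrow> bool) \<Rightarrow> ((nat \<Rightarrow> bool) \<Rightarrow> bool) \<Rightarrow> nat" where
  "re n x y = card {z \<in> mbf n. x \<le> z \<and> z \<le> y}"

definition H ::
  "nat \<Rightarrow> ((nat \<Rightarrow> bool) \<Rightarrow> bool) \<Rightarrow> ((nat \<Rightarrow> bool) \<Rightarrow> bool) \<Rightarrow> ((nat \<Rightarrow> bool) \<Rightarrow> bool) \<Rightarrow> nat" where
  "H n x y z = re n (mbf_bot n) (inf (inf x y) z) *
     (\<Sum>s \<in> {s \<in> mbf n. sup (sup x y) z \<le> s}.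
        re n (sup x y) s * re n (sup x z) s * re n (sup y z) s)"

definition H_set ::
  "nat \<Rightarrow> (((nat \<Rightarrow> bool) \<Rightarrow> bool) \<times> ((nat \<Rightarrow> bool) \<Rightarrow> bool) \<times> ((nat \<Rightarrow> bool) \<Rightarrow> bool)) set \<Rightarrow> nat" where
  "H_set n A = (\<Sum>(x, y, z)\<in>A. H n x y z)"

text \<open>
  For a permutation \<open>p\<close> of \<open>{..<n}\<close>, the map \<open>u \<mapsto> u \<circ> p\<close> preserves both \<open>cube n\<close> and its
  complement, so no restriction to the cube is needed here.
\<close>

definition perm_act :: "(nat \<Rightarrow> nat) \<Rightarrow> ((nat \<Rightarrow> bool) \<Rightarrow> bool) \<Rightarrow> (nat \<Rightarrow> bool) \<Rightarrow> bool" where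
  "perm_act p g = g \<circ> (\<lambda>u. u \<circ> p)"

definition mbf_equiv :: "nat \<Rightarrow> ((nat \<Rightarrow> bool) \<Rightarrow> bool) \<Rightarrow> ((nat \<Rightarrow> bool) \<Rightarrow> bool) \<Rightarrow> bool" where
  "mbf_equiv n f g \<longleftrightarrow> (\<exists>p. p permutes {..<n} \<and> f = perm_act p g)"

definition mbf_class :: "nat \<Rightarrow> ((nat \<Rightarrow> bool) \<Rightarrow> bool) \<Rightarrow> ((nat \<Rightarrow> bool) \<Rightarrow> bool) set" where
  "mbf_class n f = {g \<in> mbf n. mbf_equiv n f g}"

definition gam :: "nat \<Rightarrow> ((nat \<Rightarrow> bool) \<Rightarrow> bool) \<Rightarrow> nat" where
  "gam n f = card (mbf_class n f)"

definition E :: "nat \<Rightarrow> nat \<Rightarrow> ((nat \<Rightarrow> bool) \<Rightarrow> bool) set" where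
  "E n m = {f \<in> mbf n. [gam n f = 0] (mod m)}"

definition Ec :: "nat \<Rightarrow> nat \<Rightarrow> ((nat \<Rightarrow> bool) \<Rightarrow> bool) set" where
  "Ec n m = mbf n - E n m"

text \<open>
  The canonical representatives: those functions that are minimal in their class with respect
  to a total order \<open>r\<close> on \<open>mbf n\<close>, where \<open>(f, g) \<in> r\<close> means that \<open>f\<close> is below \<open>g\<close>.
\<close>

definition canon_reps ::
  "nat \<Rightarrow> (((nat \<Rightarrow> bool) \<Rightarrow> bool) \<times> ((nat \<Rightarrow> bool) \<Rightarrow> bool)) set \<Rightarrow> ((nat \<Rightarrow> bool) \<Rightarrow> bool) set" where
  "canon_reps n r = {f \<in> mbf n. \<forall>g\<in>mbf_class n f. (f, g) \<in> r}"

end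

theory Submission
  imports Defs
begin

text \<open>
  A monotone function of \<open>n + 3\<close> variables is an order-preserving map from the three-dimensional
  cube to \<open>mbf n\<close>.  Fixing its values \<open>x, y, z\<close> at the atoms and \<open>s\<close> at the top leaves
  independent choices for the bottom value (below \<open>x & y & z\<close>) and for each of the three
  coatoms, whence the exact identity \<open>d(n+3) = H(D \<times> D \<times> D)\<close>.  As \<open>H\<close> is invariant under the
  simultaneous action of a permutation, summing it over two invariant sets gives a class
  function of the remaining argument, and the sum of a class function over a class is
  \<open>\<gamma>\<close> times its value.  Classes with \<open>m\<close> dividing \<open>\<gamma>\<close> therefore contribute nothing modulo \<open>m\<close>.
\<close>

section \<open>Splitting off variables\<close>

lemma finite_cube [simp]: "finite (cube n)"
  by (simp add: cube_def finite_PiE)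

lemma finite_mbf [simp]: "finite (mbf n)"
proof (rule finite_subset)
  show "mbf n \<subseteq> cube n \<rightarrow>\<^sub>E UNIV"
    by (auto simp: mbf_def)
qed (auto intro: finite_PiE)

lemma mbf_mono: "f \<in> mbf n \<Longrightarrow> u \<in> cube n \<Longrightarrow> v \<in> cube n \<Longrightarrow> u \<le> v \<Longrightarrow> f u \<le> f v"
  unfolding mbf_def by (auto dest: mono_onD)

lemma mbf_outside: "f \<in> mbf n \<Longrightarrow> u \<notin> cube n \<Longrightarrow> f u = undefined"
  by (simp add: mbf_def PiE_iff extensional_def)

lemma mbfI:
  assumes "\<And>u. u \<notin> cube n \<Longrightarrow> f u = undefined"
    and "\<And>u v. u \<in> cube n \<Longrightarrow> v \<in> cube n \<Longrightarrow> u \<le> v \<Longrightarrow> f u \<le> f v"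
  shows "f \<in> mbf n"
  using assms unfolding mbf_def by (auto simp: PiE_iff extensional_def intro!: mono_onI)

lemma mem_cube_iff: "u \<in> cube n \<longleftrightarrow> (\<forall>i\<ge>n. u i = undefined)"
  by (auto simp: cube_def PiE_iff extensional_def)

lemma cube_upd: "u \<in> cube n \<Longrightarrow> u(n := b) \<in> cube (Suc n)"
  by (auto simp: mem_cube_iff)

text \<open>Points being extensional, coordinate \<open>n\<close> is dropped by resetting it to the
  default value.\<close>

lemma cube_restrict: "u \<in> cube (Suc n) \<Longrightarrow> u(n := undefined) \<in> cube n"
  unfolding mem_cube_iff by (metis fun_upd_apply le_antisym not_less_eq_eq)

lemma cube_upd_undefined: "u \<in> cube n \<Longrightarrow> u(n := undefined) = u"
  by (auto simp: mem_cube_iff fun_eq_iff)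

section \<open>Shannon expansion in the last variable\<close>

definition cofactor :: "nat \<Rightarrow> bool \<Rightarrow> ((nat \<Rightarrow> bool) \<Rightarrow> bool) \<Rightarrow> (nat \<Rightarrow> bool) \<Rightarrow> bool" where
  "cofactor n b f = (\<lambda>u\<in>cube n. f (u(n := b)))"

text \<open>Inverse of taking the pair of cofactors: \<open>f\<close> is the half where variable
  \<open>n\<close> is false, \<open>g\<close> the half where it is true.\<close>

definition join ::
  "nat \<Rightarrow> ((nat \<Rightarrow> bool) \<Rightarrow> bool) \<Rightarrow> ((nat \<Rightarrow> bool) \<Rightarrow> bool) \<Rightarrow> (nat \<Rightarrow> bool) \<Rightarrow> bool" where
  "join n f g = (\<lambda>u\<in>cube (Suc n). (if u n then g else f) (u(n := undefined)))"

lemma cofactor_mbf [simp]: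
  assumes "f \<in> mbf (Suc n)"
  shows "cofactor n b f \<in> mbf n"
proof (rule mbfI)
  fix u v :: "nat \<Rightarrow> bool"
  assume "u \<in> cube n" "v \<in> cube n" "u \<le> v"
  then show "cofactor n b f u \<le> cofactor n b f v"
    using mbf_mono[OF assms, of "u(n := b)" "v(n := b)"]
    by (simp add: cofactor_def cube_upd le_fun_def)
qed (simp add: cofactor_def)

lemma cofactor_le_cofactor:
  assumes "f \<in> mbf (Suc n)" "a \<le> b"
  shows "cofactor n a f \<le> cofactor n b f"
proof (rule le_funI)
  fix u :: "nat \<Rightarrow> bool"
  show "cofactor n a f u \<le> cofactor n b f u"
    using mbf_mono[OF assms(1), of "u(n := a)" "u(n := b)"] assms(2)
    by (cases "u \<in> cube n") (simp_all add: cofactor_def cube_upd le_fun_def)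
qed

lemma cofactor_mono: "f \<le> g \<Longrightarrow> cofactor n b f \<le> cofactor n b g"
  by (auto simp: cofactor_def le_fun_def)

lemma cofactor_join [simp]:
  assumes "f \<in> mbf n" "g \<in> mbf n"
  shows "cofactor n False (join n f g) = f" "cofactor n True (join n f g) = g"
  using assms
  by (auto simp: cofactor_def join_def fun_eq_iff cube_upd cube_upd_undefined mbf_outside)

lemma join_cofactor [simp]:
  assumes "f \<in> mbf (Suc n)"
  shows "join n (cofactor n False f) (cofactor n True f) = f"
proof
  fix u :: "nat \<Rightarrow> bool"
  \<comment> \<open>In each case of the split on \<open>u n\<close>, this undoes the reset of
    coordinate \<open>n\<close> inside \<open>join\<close>.\<close>
  have "u(n := u n) = u" by simp
  then show "join n (cofactor n False f) (cofactor n True f) u = f u"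
    using assms
    by (cases "u n") (auto simp: cofactor_def join_def cube_restrict mbf_outside)
qed

lemma join_mbf [simp]:
  assumes "f \<in> mbf n" "g \<in> mbf n" "f \<le> g"
  shows "join n f g \<in> mbf (Suc n)"
proof (rule mbfI)
  fix u v :: "nat \<Rightarrow> bool"
  assume uv: "u \<in> cube (Suc n)" "v \<in> cube (Suc n)" "u \<le> v"
  let ?u = "u(n := undefined)" and ?v = "v(n := undefined)"
  have *: "?u \<in> cube n" "?v \<in> cube n" "?u \<le> ?v"
    using uv by (auto simp: cube_restrict le_fun_def)
  then have "f ?u \<le> f ?v" "g ?u \<le> g ?v"
    using assms mbf_mono by blast+
  \<comment> \<open>For the mixed case, where \<open>u n\<close> is false and \<open>v n\<close> is
    true: there \<open>f ?u \<le> f ?v \<le> g ?v\<close>.\<close>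
  moreover have "f ?v \<le> g ?v"
    using assms(3) by (simp add: le_fun_def)
  moreover have "u n \<le> v n"
    using uv(3) by (simp add: le_fun_def)
  ultimately show "join n f g u \<le> join n f g v"
    using uv(1,2) by (auto simp: join_def)
qed (auto simp: join_def)

text \<open>Comparisons pass to cofactors. As a simp rule this reduces the monotonicity of nested
  joins to comparisons along edges of the small cube.\<close>

lemma join_le_join [simp]:
  assumes "f \<in> mbf n" "g \<in> mbf n" "f' \<in> mbf n" "g' \<in> mbf n"
  shows "join n f g \<le> join n f' g' \<longleftrightarrow> f \<le> f' \<and> g \<le> g'"
proof
  assume "join n f g \<le> join n f' g'"
  then show "f \<le> f' \<and> g \<le> g'"
    using assms by (metis cofactor_join cofactor_mono)
next
  assume "f \<le> f' \<and> g \<le> g'"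
  then show "join n f g \<le> join n f' g'"
    by (auto simp: join_def le_fun_def)
qed

lemma mbf_bot_le: "f \<in> mbf n \<Longrightarrow> mbf_bot n \<le> f"
  by (auto simp: mbf_bot_def le_fun_def mbf_outside)

lemma card_mbf_add_3: "card (mbf (n + 3)) = H_set n (mbf n \<times> mbf n \<times> mbf n)"
proof -
  let ?M = "mbf n"
  let ?I = "\<lambda>a b. {g \<in> ?M. a \<le> g \<and> g \<le> b}"
  \<comment> \<open>The top value \<open>s\<close> is chosen before the three coatom values: their
    intervals depend on \<open>s\<close> but not on one another, so they form a plain
    product.\<close>
  let ?B = "\<lambda>x y z. ?I (mbf_bot n) (inf (inf x y) z) \<times>
      (SIGMA s:{s \<in> ?M. sup (sup x y) z \<le> s}.
        ?I (sup x y) s \<times> ?I (sup x z) s \<times> ?I (sup y z) s)"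
  let ?T = "SIGMA (x, y, z):?M \<times> ?M \<times> ?M. ?B x y z"
  let ?c0 = "cofactor n" and ?c1 = "cofactor (Suc n)" and ?c2 = "cofactor (Suc (Suc n))"
  \<comment> \<open>The value at the vertex \<open>(a, b, c)\<close> of the small cube: variables
    \<open>n\<close>, \<open>n + 1\<close>, \<open>n + 2\<close> are fixed to \<open>a\<close>,
    \<open>b\<close>, \<open>c\<close>, the last one first.\<close>
  let ?k = "\<lambda>a b c f. ?c0 a (?c1 b (?c2 c f))"
  let ?d = "\<lambda>f. ((?k True False False f, ?k False True False f, ?k False False True f),
      (?k False False False f, (?k True True True f,
        (?k True True False f, ?k True False True f, ?k False True True f))))"
  \<comment> \<open>The eight values in vertex order; \<open>p\<close>, \<open>q\<close>,
    \<open>r\<close> are the coatoms above \<open>x, y\<close>, above \<open>x, z\<close> and above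
    \<open>y, z\<close>.\<close>
  let ?e = "\<lambda>((x, y, z), (b, (s, (p, q, r)))).
      join (Suc (Suc n)) (join (Suc n) (join n b x) (join n y p))
        (join (Suc n) (join n z q) (join n r s))"
  \<comment> \<open>Monotone in the vertex, by raising one coordinate at a time; this yields all the
    inequalities that \<open>?T\<close> demands.\<close>
  have k_mono: "?k a b c f \<le> ?k a' b' c' f"
    if "f \<in> mbf (Suc (Suc (Suc n)))" "a \<le> a'" "b \<le> b'" "c \<le> c'" for f a b c a' b' c'
  proof -
    have "?k a b c f \<le> ?k a b c' f"
      using that by (intro cofactor_mono cofactor_le_cofactor)
    also have "\<dots> \<le> ?k a b' c' f"
      using that by (intro cofactor_mono cofactor_le_cofactor cofactor_mbf)
    also have "\<dots> \<le> ?k a' b' c' f"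
      using that by (intro cofactor_le_cofactor cofactor_mbf)
    finally show ?thesis .
  qed
  have "bij_betw ?d (mbf (Suc (Suc (Suc n)))) ?T"
  proof (rule bij_betw_byWitness[where f' = ?e])
    show "\<forall>f\<in>mbf (Suc (Suc (Suc n))). ?e (?d f) = f"
      by simp
    show "\<forall>t\<in>?T. ?d (?e t) = t"
      by auto
    show "?d ` mbf (Suc (Suc (Suc n))) \<subseteq> ?T"
      by (rule image_subsetI) (simp add: mbf_bot_le k_mono)
    show "?e ` ?T \<subseteq> mbf (Suc (Suc (Suc n)))"
      by auto
  qed
  then have "card (mbf (n + 3)) = card ?T"
    by (simp add: bij_betw_same_card numeral_3_eq_3)
  also have "\<dots> = (\<Sum>(x, y, z)\<in>?M \<times> ?M \<times> ?M. card (?B x y z))"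
    by (subst card_SigmaI) (auto intro!: sum.cong)
  also have "\<dots> = H_set n (?M \<times> ?M \<times> ?M)"
    unfolding H_set_def H_def re_def
    by (intro sum.cong refl) (auto simp: card_cartesian_product mult.assoc)
  finally show ?thesis .
qed

section \<open>Invariance under permutations of the variables\<close>

text \<open>Precomposition reverses the order twice, once on points and once on functions, so this
  is a left action.\<close>

lemma perm_act_perm_act: "perm_act p (perm_act q f) = perm_act (p \<circ> q) f"
  by (simp add: perm_act_def fun_eq_iff comp_assoc)

lemma perm_act_id [simp]: "perm_act id f = f"
  by (simp add: perm_act_def fun_eq_iff)

lemma perm_act_inv:
  assumes "p permutes S"
  shows "perm_act (inv p) (perm_act p f) = f" "perm_act p (perm_act (inv p) f) = f"
  using assms by (simp_all add: perm_act_perm_act permutes_inv_o)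

text \<open>The permutation fixes every index from \<open>n\<close> on, which is where membership in
  the cube is decided.\<close>

lemma cube_comp_iff:
  assumes "p permutes {..<n}"
  shows "u \<circ> p \<in> cube n \<longleftrightarrow> u \<in> cube n"
  using permutes_not_in[OF assms] by (simp add: mem_cube_iff)

lemma perm_act_mbf [simp]:
  assumes "p permutes {..<n}" "f \<in> mbf n"
  shows "perm_act p f \<in> mbf n"
proof (rule mbfI)
  fix u v :: "nat \<Rightarrow> bool"
  assume "u \<in> cube n" "v \<in> cube n" "u \<le> v"
  then show "perm_act p f u \<le> perm_act p f v"
    using mbf_mono[OF assms(2), of "u \<circ> p" "v \<circ> p"] assms(1)
    by (simp add: perm_act_def cube_comp_iff le_fun_def)
qed (use assms in \<open>simp add: perm_act_def cube_comp_iff mbf_outside\<close>)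

lemma perm_act_mono: "f \<le> g \<Longrightarrow> perm_act p f \<le> perm_act p g"
  by (simp add: perm_act_def le_fun_def)

lemma perm_act_le_iff:
  assumes "p permutes S"
  shows "perm_act p f \<le> perm_act p g \<longleftrightarrow> f \<le> g"
  by (metis assms perm_act_inv(1) perm_act_mono)

lemma perm_act_sup: "perm_act p (sup f g) = sup (perm_act p f) (perm_act p g)"
  by (simp add: perm_act_def fun_eq_iff)

lemma perm_act_inf: "perm_act p (inf f g) = inf (perm_act p f) (perm_act p g)"
  by (simp add: perm_act_def fun_eq_iff)

lemma perm_act_bot:
  assumes "p permutes {..<n}"
  shows "perm_act p (mbf_bot n) = mbf_bot n"
  using assms by (simp add: perm_act_def mbf_bot_def fun_eq_iff cube_comp_iff restrict_def)

text \<open>These are the unions of classes; the notion treats \<open>mbf n\<close>,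
  \<open>E n m\<close> and \<open>Ec n m\<close> uniformly.\<close>

definition invariant :: "nat \<Rightarrow> ((nat \<Rightarrow> bool) \<Rightarrow> bool) set \<Rightarrow> bool" where
  "invariant n S \<longleftrightarrow> S \<subseteq> mbf n \<and> (\<forall>p. p permutes {..<n} \<longrightarrow> (\<forall>f\<in>S. perm_act p f \<in> S))"

lemma invariantD:
  "invariant n S \<Longrightarrow> p permutes {..<n} \<Longrightarrow> f \<in> S \<Longrightarrow> perm_act p f \<in> S"
  by (simp add: invariant_def)

lemma invariant_subset: "invariant n S \<Longrightarrow> S \<subseteq> mbf n"
  by (simp add: invariant_def)

lemma invariant_mbf: "invariant n (mbf n)"
  by (simp add: invariant_def)

lemma bij_betw_perm_act:
  assumes "p permutes {..<n}"
    and "\<And>f. f \<in> A \<Longrightarrow> perm_act p f \<in> B" "\<And>f. f \<in> B \<Longrightarrow> perm_act (inv p) f \<in> A"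
  shows "bij_betw (perm_act p) A B"
  by (rule bij_betw_byWitness[where f' = "perm_act (inv p)"])
     (use assms in \<open>auto simp: perm_act_inv[OF assms(1)]\<close>)

text \<open>Shifts the permutation across an inequality, for checking that the inverse maps back
  between sets cut out by inequalities.\<close>

lemma perm_act_inv_le_iff:
  assumes "p permutes S"
  shows "perm_act (inv p) f \<le> g \<longleftrightarrow> f \<le> perm_act p g" "f \<le> perm_act (inv p) g \<longleftrightarrow> perm_act p f \<le> g"
  by (metis assms perm_act_inv(2) perm_act_le_iff)+

lemma bij_betw_perm_act_invariant:
  assumes "p permutes {..<n}" "invariant n S"
  shows "bij_betw (perm_act p) S S"
  using assms by (intro bij_betw_perm_act) (auto intro: invariantD permutes_inv)

text \<open>The action is by order automorphisms of \<open>mbf n\<close>, which carry intervals onto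
  intervals.\<close>

lemma re_perm_act:
  assumes "p permutes {..<n}"
  shows "re n (perm_act p x) (perm_act p y) = re n x y"
proof -
  have "bij_betw (perm_act p) {z \<in> mbf n. x \<le> z \<and> z \<le> y}
      {z \<in> mbf n. perm_act p x \<le> z \<and> z \<le> perm_act p y}"
    using assms
    by (intro bij_betw_perm_act)
       (auto simp: permutes_inv perm_act_mono perm_act_inv_le_iff)
  then show ?thesis
    unfolding re_def by (simp add: bij_betw_same_card)
qed

text \<open>\<open>H\<close> is built from order, suprema, infima and bottom alone, all respected by
  the action; the summation variable \<open>s\<close> is reindexed by the permutation.\<close>

lemma H_perm_act:
  assumes p: "p permutes {..<n}"
  shows "H n (perm_act p x) (perm_act p y) (perm_act p z) = H n x y z"
proof -
  let ?U = "\<lambda>x y z. {s \<in> mbf n. sup (sup x y) z \<le> s}"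
  let ?t = "\<lambda>x y z s. re n (sup x y) s * re n (sup x z) s * re n (sup y z) s"
  let ?p = "perm_act p"
  have bij: "bij_betw ?p (?U x y z) (?U (?p x) (?p y) (?p z))"
    using p
    by (intro bij_betw_perm_act)
       (auto simp: permutes_inv perm_act_mono perm_act_inv_le_iff)
  have "(\<Sum>s\<in>?U (?p x) (?p y) (?p z). ?t (?p x) (?p y) (?p z) s) = (\<Sum>s\<in>?U x y z. ?t x y z s)"
    using p
    by (subst sum.reindex_bij_betw[OF bij, symmetric])
       (simp add: perm_act_sup[symmetric] re_perm_act)
  moreover have "re n (mbf_bot n) (inf (inf (?p x) (?p y)) (?p z)) =
      re n (mbf_bot n) (inf (inf x y) z)"
    using re_perm_act[OF p, of "mbf_bot n" "inf (inf x y) z"]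
    by (simp add: perm_act_inf perm_act_bot[OF p])
  ultimately show ?thesis
    by (simp add: H_def)
qed

text \<open>Simultaneous invariance becomes invariance in one argument once the other two are summed
  over invariant sets. Each position of that argument gets its own version.\<close>

lemma H_sum_perm_act:
  assumes p: "p permutes {..<n}" and S: "invariant n S" "invariant n T"
  shows "(\<Sum>y\<in>S. \<Sum>z\<in>T. H n (perm_act p x) y z) = (\<Sum>y\<in>S. \<Sum>z\<in>T. H n x y z)"
    and "(\<Sum>x\<in>S. \<Sum>z\<in>T. H n x (perm_act p y) z) = (\<Sum>x\<in>S. \<Sum>z\<in>T. H n x y z)"
    and "(\<Sum>x\<in>S. \<Sum>y\<in>T. H n x y (perm_act p z)) = (\<Sum>x\<in>S. \<Sum>y\<in>T. H n x y z)"
proof -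
  note * = bij_betw_perm_act_invariant[OF p]
  \<comment> \<open>Replacing both summation variables by their images puts the permutation on all
    three arguments of \<open>H\<close>, where \<open>H_perm_act\<close> removes it.\<close>
  have reindex: "(\<Sum>a\<in>S. \<Sum>b\<in>T. g (perm_act p a) (perm_act p b)) = (\<Sum>a\<in>S. \<Sum>b\<in>T. g a b)"
    for g :: "_ \<Rightarrow> _ \<Rightarrow> nat"
    using sum.reindex_bij_betw[OF *[OF S(1)], of "\<lambda>a. \<Sum>b\<in>T. g a b"]
      sum.reindex_bij_betw[OF *[OF S(2)], of "g _"]
    by simp
  show "(\<Sum>y\<in>S. \<Sum>z\<in>T. H n (perm_act p x) y z) = (\<Sum>y\<in>S. \<Sum>z\<in>T. H n x y z)"
    using reindex[of "H n (perm_act p x)"] by (simp add: H_perm_act[OF p])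
  show "(\<Sum>x\<in>S. \<Sum>z\<in>T. H n x (perm_act p y) z) = (\<Sum>x\<in>S. \<Sum>z\<in>T. H n x y z)"
    using reindex[of "\<lambda>x z. H n x (perm_act p y) z"] by (simp add: H_perm_act[OF p])
  show "(\<Sum>x\<in>S. \<Sum>y\<in>T. H n x y (perm_act p z)) = (\<Sum>x\<in>S. \<Sum>y\<in>T. H n x y z)"
    using reindex[of "\<lambda>x y. H n x y (perm_act p z)"] by (simp add: H_perm_act[OF p])
qed

section \<open>Summing over classes\<close>

lemma mbf_equiv_refl: "mbf_equiv n f f"
  unfolding mbf_equiv_def by (metis permutes_id perm_act_id)

lemma mbf_equiv_sym: "mbf_equiv n f g \<Longrightarrow> mbf_equiv n g f"
  unfolding mbf_equiv_def by (metis permutes_inv perm_act_inv(1))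

lemma mbf_equiv_trans: "mbf_equiv n f g \<Longrightarrow> mbf_equiv n g h \<Longrightarrow> mbf_equiv n f h"
  unfolding mbf_equiv_def by (metis permutes_compose perm_act_perm_act)

lemma mbf_class_eq: "mbf_equiv n f g \<Longrightarrow> mbf_class n f = mbf_class n g"
  unfolding mbf_class_def by (blast intro: mbf_equiv_sym mbf_equiv_trans)

lemma mbf_equiv_perm_act: "p permutes {..<n} \<Longrightarrow> mbf_equiv n (perm_act p f) f"
  by (auto simp: mbf_equiv_def)

lemma gam_perm_act: "p permutes {..<n} \<Longrightarrow> gam n (perm_act p f) = gam n f"
  by (simp add: gam_def mbf_class_eq[OF mbf_equiv_perm_act])

lemma invariant_E: "invariant n (E n m)"
  by (auto simp: invariant_def E_def gam_perm_act)

lemma invariant_Ec: "invariant n (Ec n m)"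
  by (auto simp: invariant_def Ec_def E_def gam_perm_act)

text \<open>Supplies a canonical representative in every class. In the induction the new element is
  compared with the minimum found so far.\<close>

lemma linear_order_on_finite_min:
  assumes "linear_order_on A r" "finite B" "B \<noteq> {}" "B \<subseteq> A"
  shows "\<exists>b\<in>B. \<forall>c\<in>B. (b, c) \<in> r"
  using assms(2-4)
proof (induction rule: finite_ne_induct)
  case (singleton x)
  then show ?case
    using assms(1) by (auto simp: order_on_defs refl_on_def)
next
  case (insert x F)
  then obtain b where b: "b \<in> F" "\<And>c. c \<in> F \<Longrightarrow> (b, c) \<in> r"
    by auto
  have r: "trans r" "(x, x) \<in> r" "(x, b) \<in> r \<or> (b, x) \<in> r"
    using assms(1) insert.prems insert.hyps(3) b(1)
    by (auto simp: order_on_defs refl_on_def total_on_def)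
  show ?case
  proof (cases "(x, b) \<in> r")
    case True
    then have "\<forall>c\<in>insert x F. (x, c) \<in> r"
      using b(2) r(1,2) by (auto dest: transD)
    then show ?thesis by blast
  next
    case False
    then have "\<forall>c\<in>insert x F. (b, c) \<in> r"
      using b(2) r(3) by blast
    then show ?thesis using b(1) by blast
  qed
qed

text \<open>\<open>S\<close> is the disjoint union of the classes of its canonical representatives,
  and \<open>F\<close> is constant on each. The equality is exact, so it serves both for discarding
  \<open>E n m\<close> and for the final formula.\<close>

lemma sum_class_function:
  fixes F :: "((nat \<Rightarrow> bool) \<Rightarrow> bool) \<Rightarrow> nat"
  assumes r: "linear_order_on (mbf n) r" and S: "invariant n S"
    and F: "\<And>p f. p permutes {..<n} \<Longrightarrow> f \<in> S \<Longrightarrow> F (perm_act p f) = F f"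
  shows "(\<Sum>f\<in>S. F f) = (\<Sum>f\<in>canon_reps n r \<inter> S. gam n f * F f)"
proof -
  let ?R = "canon_reps n r \<inter> S"
  note SM = invariant_subset[OF S]
  have fin: "finite ?R" "finite (mbf_class n f)" for f
    using finite_subset[OF SM finite_mbf] by (auto simp: mbf_class_def)
  have orbit: "\<exists>p. p permutes {..<n} \<and> g = perm_act p f" if "g \<in> mbf_class n f" for f g
    using mbf_equiv_sym[of n f g] that by (auto simp: mbf_class_def mbf_equiv_def)
  have sub: "mbf_class n f \<subseteq> S" if "f \<in> S" for f
    using orbit invariantD[OF S] that by blast
  \<comment> \<open>Two representatives of one class lie below each other, so antisymmetry
    identifies them.\<close>
  have disj: "mbf_class n f \<inter> mbf_class n g = {}" if fg: "f \<in> ?R" "g \<in> ?R" "f \<noteq> g" for f g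
  proof (rule ccontr)
    assume "mbf_class n f \<inter> mbf_class n g \<noteq> {}"
    then have "mbf_equiv n f g"
      unfolding mbf_class_def by (blast intro: mbf_equiv_sym mbf_equiv_trans)
    then have "(f, g) \<in> r" "(g, f) \<in> r"
      using fg(1,2) SM by (auto simp: canon_reps_def mbf_class_def dest: mbf_equiv_sym)
    then show False
      using r fg(3) by (auto simp: order_on_defs antisym_def)
  qed
  \<comment> \<open>The representative is the \<open>r\<close>-least element \<open>g\<close> of the
    class of \<open>f\<close>; it is canonical because its class is the same.\<close>
  have cover: "\<exists>g\<in>?R. f \<in> mbf_class n g" if f: "f \<in> S" for f
  proof -
    have ne: "mbf_class n f \<noteq> {}"
      using f SM mbf_equiv_refl by (auto simp: mbf_class_def)
    have "mbf_class n f \<subseteq> mbf n"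
      using sub[OF f] SM by blast
    then obtain g where g: "g \<in> mbf_class n f" "\<forall>h\<in>mbf_class n f. (g, h) \<in> r"
      using linear_order_on_finite_min[OF r fin(2) ne] by blast
    then have equiv: "mbf_equiv n g f"
      by (auto simp: mbf_class_def intro: mbf_equiv_sym)
    then have "g \<in> ?R"
      using g sub[OF f] SM by (auto simp: canon_reps_def mbf_class_eq[OF equiv])
    then show ?thesis
      using equiv f SM by (auto simp: mbf_class_def)
  qed
  have "S = (\<Union>g\<in>?R. mbf_class n g)"
    using cover sub by blast
  then have "(\<Sum>f\<in>S. F f) = (\<Sum>f\<in>(\<Union>g\<in>?R. mbf_class n g). F f)"
    by simp
  also have "\<dots> = (\<Sum>g\<in>?R. \<Sum>f\<in>mbf_class n g. F f)"
    using fin disj by (intro sum.UNION_disjoint) auto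
  also have "\<dots> = (\<Sum>g\<in>?R. \<Sum>f\<in>mbf_class n g. F g)"
    using orbit F by (intro sum.cong refl) fastforce
  also have "\<dots> = (\<Sum>g\<in>?R. gam n g * F g)"
    by (simp add: gam_def)
  finally show ?thesis .
qed

text \<open>The sum over \<open>E n m\<close>, grouped into classes, has a factor
  \<open>gam n f\<close> divisible by \<open>m\<close> in every term.\<close>

lemma sum_mbf_cong_sum_Ec:
  fixes F :: "((nat \<Rightarrow> bool) \<Rightarrow> bool) \<Rightarrow> nat"
  assumes r: "linear_order_on (mbf n) r"
    and F: "\<And>p f. p permutes {..<n} \<Longrightarrow> F (perm_act p f) = F f"
  shows "[(\<Sum>f\<in>mbf n. F f) = (\<Sum>f\<in>Ec n m. F f)] (mod m)"
proof -
  have "m dvd (\<Sum>f\<in>canon_reps n r \<inter> E n m. gam n f * F f)"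
    by (intro dvd_sum dvd_mult2) (auto simp: E_def cong_0_iff)
  then have "[(\<Sum>f\<in>E n m. F f) = 0] (mod m)"
    by (simp add: sum_class_function[OF r invariant_E F] cong_0_iff)
  moreover have "(\<Sum>f\<in>mbf n. F f) = (\<Sum>f\<in>Ec n m. F f) + (\<Sum>f\<in>E n m. F f)"
    unfolding Ec_def by (rule sum.subset_diff) (auto simp: E_def)
  ultimately show ?thesis
    by (metis add.right_neutral cong_add cong_refl)
qed

section \<open>Reduction of all three arguments modulo \<open>m\<close>\<close>

lemma H_set_times: "H_set n (A \<times> B \<times> C) = (\<Sum>x\<in>A. \<Sum>y\<in>B. \<Sum>z\<in>C. H n x y z)"
  by (simp add: H_set_def sum.cartesian_product)

lemma H_set_cong_Ec:
  assumes r: "linear_order_on (mbf n) r"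
  shows "[H_set n (mbf n \<times> mbf n \<times> mbf n) = H_set n (Ec n m \<times> Ec n m \<times> Ec n m)] (mod m)"
proof -
  let ?D = "mbf n" and ?C = "Ec n m"
  note inv = invariant_mbf invariant_Ec
  have "[(\<Sum>x\<in>?D. \<Sum>y\<in>?D. \<Sum>z\<in>?D. H n x y z) = (\<Sum>x\<in>?C. \<Sum>y\<in>?D. \<Sum>z\<in>?D. H n x y z)] (mod m)"
    by (rule sum_mbf_cong_sum_Ec[OF r]) (rule H_sum_perm_act inv | assumption)+
  \<comment> \<open>The reduction acts on the outermost sum, so each argument is brought to the
    front in turn.\<close>
  also have "(\<Sum>x\<in>?C. \<Sum>y\<in>?D. \<Sum>z\<in>?D. H n x y z) = (\<Sum>y\<in>?D. \<Sum>x\<in>?C. \<Sum>z\<in>?D. H n x y z)"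
    by (rule sum.swap)
  also have "[\<dots> = (\<Sum>y\<in>?C. \<Sum>x\<in>?C. \<Sum>z\<in>?D. H n x y z)] (mod m)"
    by (rule sum_mbf_cong_sum_Ec[OF r]) (rule H_sum_perm_act inv | assumption)+
  also have "(\<Sum>y\<in>?C. \<Sum>x\<in>?C. \<Sum>z\<in>?D. H n x y z) = (\<Sum>z\<in>?D. \<Sum>x\<in>?C. \<Sum>y\<in>?C. H n x y z)"
    \<comment> \<open>With the inner range fixed to \<open>?D\<close>, only the sum over
      \<open>z\<close> moves outwards and the rewriting terminates.\<close>
    by (subst sum.swap) (simp add: sum.swap[where B = ?D])
  also have "[\<dots> = (\<Sum>z\<in>?C. \<Sum>x\<in>?C. \<Sum>y\<in>?C. H n x y z)] (mod m)"
    by (rule sum_mbf_cong_sum_Ec[OF r]) (rule H_sum_perm_act inv | assumption)+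
  also have "(\<Sum>z\<in>?C. \<Sum>x\<in>?C. \<Sum>y\<in>?C. H n x y z) = (\<Sum>x\<in>?C. \<Sum>y\<in>?C. \<Sum>z\<in>?C. H n x y z)"
    by (subst sum.swap) (rule sum.cong[OF refl], rule sum.swap)
  finally show ?thesis
    by (simp add: H_set_times)
qed

theorem theorem10:
  fixes n m :: nat
    and r :: "(((nat \<Rightarrow> bool) \<Rightarrow> bool) \<times> ((nat \<Rightarrow> bool) \<Rightarrow> bool)) set"
  assumes "m > 1"
    and "linear_order_on (mbf n) r"
  shows "[card (mbf (n + 3)) = H_set n (mbf n \<times> mbf n \<times> mbf n)] (mod m)
    \<and> [H_set n (mbf n \<times> mbf n \<times> mbf n) = H_set n (Ec n m \<times> Ec n m \<times> Ec n m)] (mod m)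
    \<and> [card (mbf (n + 3)) =
         (\<Sum>x \<in> canon_reps n r \<inter> Ec n m. \<Sum>y \<in> Ec n m. \<Sum>z \<in> Ec n m. gam n x * H n x y z)] (mod m)"
proof -
  note r = assms(2)
  note Ec = invariant_Ec[of n m]
  \<comment> \<open>Grouping the sum over \<open>x\<close> is exact since \<open>Ec n m\<close> is a
    union of classes; congruence enters only in passing from \<open>mbf n\<close> to
    \<open>Ec n m\<close>.\<close>
  have "H_set n (Ec n m \<times> Ec n m \<times> Ec n m) =
      (\<Sum>x \<in> canon_reps n r \<inter> Ec n m. gam n x * (\<Sum>y \<in> Ec n m. \<Sum>z \<in> Ec n m. H n x y z))"
    unfolding H_set_times
    by (rule sum_class_function[OF r Ec]) (rule H_sum_perm_act(1)[OF _ Ec Ec])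
  then show ?thesis
    using H_set_cong_Ec[OF r, of m] by (simp add: card_mbf_add_3 sum_distrib_left)
qed

end
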